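(* For every $n\ge 0$, there is a bijection between the set of partitions of $\{1,2,\dots,n\}$ and the set of t-shelves of size $n$ in which no node that is a left child of its parent has a right child.
   Context: A treeshelf (t-shelf) of size $n\ge 1$ is a rooted binary tree with $n$ nodes labeled bijectively by $\{1,\dots,n\}$ so that labels strictly increase along every path starting at the root, in which every node has at most one left child and at most one right child, and every child (including a child with no sibling) is designated either as the left child or the right child of its parent. There is a unique empty t-shelf, of size $0$. *)

theory Defs
  imports "HOL-Library.Tree" "HOL-Library.Disjoint_Sets"
begin

(* Nodes are the non-Leaf subtrees; Leaf stands for a missing child (or the empty t-shelf),
   so a child without sibling is still designated as left or right. *)

fun increasing_tree :: "nat tree \<Rightarrow> bool" where
  "increasing_tree \<langle>\<rangle> \<longleftrightarrow> True"
| "increasing_tree \<langle>l, a, r\<rangle> \<longleftrightarrow>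
     (\<forall>x \<in> set_tree l \<union> set_tree r. a < x) \<and> increasing_tree l \<and> increasing_tree r"

definition t_shelf :: "nat \<Rightarrow> nat tree \<Rightarrow> bool" where
  "t_shelf n t \<longleftrightarrow>
     size t = n \<and> distinct (inorder t) \<and> set_tree t = {1..n} \<and> increasing_tree t"

definition no_left_child_has_right_child :: "'a tree \<Rightarrow> bool" where
  "no_left_child_has_right_child t \<longleftrightarrow>
     (\<forall>ll b lr a r. \<langle>\<langle>ll, b, lr\<rangle>, a, r\<rangle> \<in> subtrees t \<longrightarrow> lr = \<langle>\<rangle>)"

end

theory Submission
  imports Defs
begin

text \<open>
  In a t-shelf where no left child has a right child, every left subtree is a path of left
  children. The tree is therefore its right spine with a left path hanging from each spine node.
  Each spine node together with its left path is a block: the spine node is its minimum, and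
  the path lists the rest in increasing order. Since the spine lists the blocks by increasing
  minimum, the set of blocks determines the tree, and every partition arises in this way.
\<close>

fun blocks :: "'a tree \<Rightarrow> 'a set set" where
  "blocks \<langle>\<rangle> = {}"
| "blocks \<langle>l, a, r\<rangle> = insert (insert a (set_tree l)) (blocks r)"

text \<open>The label set is a parameter because the labels of a subtree need not form an interval
  starting at 1, and the inductions descend into subtrees.\<close>

definition left_path_shelf_on :: "nat set \<Rightarrow> nat tree \<Rightarrow> bool" where
  "left_path_shelf_on A t \<longleftrightarrow> distinct (inorder t) \<and> increasing_tree t \<and>
     no_left_child_has_right_child t \<and> set_tree t = A"

lemma no_left_child_has_right_child_Leaf [simp]: "no_left_child_has_right_child \<langle>\<rangle>"
  by (simp add: no_left_child_has_right_child_def)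

text \<open>The selector \<^const>\<open>right\<close> maps the empty tree to the empty tree.\<close>

lemma no_left_child_has_right_child_Node [simp]:
  "no_left_child_has_right_child \<langle>l, a, r\<rangle> \<longleftrightarrow>
     right l = \<langle>\<rangle> \<and> no_left_child_has_right_child l \<and> no_left_child_has_right_child r"
  by (cases l; simp add: no_left_child_has_right_child_def; blast)

lemma left_path_shelf_on_Leaf [simp]: "left_path_shelf_on A \<langle>\<rangle> \<longleftrightarrow> A = {}"
  by (auto simp: left_path_shelf_on_def)

lemma left_path_shelf_on_Node:
  "left_path_shelf_on A \<langle>l, a, r\<rangle> \<longleftrightarrow>
     left_path_shelf_on (set_tree l) l \<and> left_path_shelf_on (set_tree r) r \<and>
     right l = \<langle>\<rangle> \<and> set_tree l \<inter> set_tree r = {} \<and>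
     (\<forall>x \<in> set_tree l \<union> set_tree r. a < x) \<and> A = insert a (set_tree l \<union> set_tree r)"
  by (auto simp: left_path_shelf_on_def)

lemma left_path_shelf_on_set_tree: "left_path_shelf_on A t \<Longrightarrow> set_tree t = A"
  by (simp add: left_path_shelf_on_def)

lemma Union_blocks_subset: "\<Union> (blocks t) \<subseteq> set_tree t"
  by (induction t) auto

text \<open>Induction down the right spine: the root block is nonempty and, labels being distinct,
  misses the right subtree, whose labels the remaining blocks partition.\<close>

lemma partition_on_blocks: "left_path_shelf_on A t \<Longrightarrow> partition_on A (blocks t)"
proof (induction t arbitrary: A)
  case Leaf
  then show ?case by (simp add: partition_on_empty)
next
  case (Node l a r)
  let ?B = "insert a (set_tree l)"
  have disj: "?B \<inter> set_tree r = {}" and A: "A = ?B \<union> set_tree r"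
    using Node.prems by (auto simp: left_path_shelf_on_Node)
  have "partition_on (set_tree r) (blocks r)"
    using Node by (auto simp: left_path_shelf_on_Node)
  moreover have "disjnt ?B (\<Union> (blocks r))"
    using disj Union_blocks_subset[of r] unfolding disjnt_def by blast
  moreover have "A - ?B = set_tree r"
    using disj A by blast
  ultimately show ?case
    using A by (auto simp: partition_on_insert)
qed

text \<open>The root can only be the minimum of \<open>A\<close>, and the left subtree is again such
  a path, on the other labels.\<close>

lemma left_path_shelf_on_left_path_unique:
  assumes "left_path_shelf_on A t" "left_path_shelf_on A t'" "right t = \<langle>\<rangle>" "right t' = \<langle>\<rangle>"
  shows "t = t'"
  using assms
proof (induction t arbitrary: A t')
  case Leaf
  then show ?case by (cases t') (auto simp: left_path_shelf_on_Node)
next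
  case (Node l a r)
  from Node.prems obtain l' a' where t': "t' = \<langle>l', a', \<langle>\<rangle>\<rangle>"
    by (cases t') (auto simp: left_path_shelf_on_Node)
  have ins: "insert a (set_tree l) = insert a' (set_tree l')"
    and lt: "\<forall>x \<in> set_tree l. a < x" "\<forall>x \<in> set_tree l'. a' < x"
    using Node.prems t' by (auto simp: left_path_shelf_on_Node)
  \<comment> \<open>Otherwise each root would lie in the other's left subtree, giving both
    \<open>a < a'\<close> and \<open>a' < a\<close>.\<close>
  then have "a = a'"
    by (metis insert_iff not_less_iff_gr_or_eq)
  with ins lt have "set_tree l = set_tree l'"
    by (metis insert_ident less_irrefl)
  with Node t' have "l = l'"
    by (auto simp: left_path_shelf_on_Node)
  with \<open>a = a'\<close> t' Node.prems show ?case by simp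
qed

text \<open>Adding labels in decreasing order, each new one can become the root above the path built
  so far.\<close>

lemma left_path_shelf_on_left_path_exists:
  assumes "finite A"
  shows "\<exists>t. left_path_shelf_on A t \<and> right t = \<langle>\<rangle>"
  using assms
proof (induction A rule: finite_linorder_min_induct)
  case empty
  then show ?case by (intro exI[of _ "\<langle>\<rangle>"]) simp
next
  case (insert b A)
  then obtain t where "left_path_shelf_on A t" "right t = \<langle>\<rangle>" by blast
  with insert show ?case
    by (intro exI[of _ "\<langle>t, b, \<langle>\<rangle>\<rangle>"])
      (auto simp: left_path_shelf_on_Node left_path_shelf_on_set_tree)
qed

text \<open>The root is the minimum of \<open>A\<close> and its block is the one containing it,
  which fixes the left path. Deleting that block leaves equal blocks for the right subtrees, where
  induction applies.\<close>

lemma inj_on_blocks: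
  assumes "left_path_shelf_on A t" "left_path_shelf_on A t'" "blocks t = blocks t'"
  shows "t = t'"
  using assms
proof (induction t arbitrary: A t')
  case Leaf
  then show ?case by (cases t') auto
next
  case (Node l a r)
  from Node.prems obtain l' a' r' where t': "t' = \<langle>l', a', r'\<rangle>"
    by (cases t') auto
  let ?B = "insert a (set_tree l)" and ?B' = "insert a' (set_tree l')"
  note shelf = Node.prems(1) [unfolded left_path_shelf_on_Node]
  note shelf' = Node.prems(2) [unfolded t' left_path_shelf_on_Node]
  have "a \<in> A \<and> (\<forall>x\<in>A. a \<le> x)"
    using shelf by (auto intro: less_imp_le)
  moreover have "a' \<in> A \<and> (\<forall>x\<in>A. a' \<le> x)"
    using shelf' by (auto intro: less_imp_le)
  ultimately have a: "a = a'"
    by (meson order_antisym)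
  \<comment> \<open>Equality of the block sets puts both root blocks into one partition; sharing
    \<open>a\<close>, they coincide.\<close>
  have "partition_on A (blocks \<langle>l, a, r\<rangle>)"
    using Node.prems(1) by (rule partition_on_blocks)
  moreover have "?B \<in> blocks \<langle>l, a, r\<rangle>" "?B' \<in> blocks \<langle>l, a, r\<rangle>"
    using Node.prems(3) t' by auto
  moreover have "a \<in> ?B \<inter> ?B'"
    using a by simp
  ultimately have B: "?B = ?B'"
    by (metis partition_onD2 disjointD empty_iff)
  with a shelf shelf' have "set_tree l = set_tree l'"
    by (metis UnI1 insert_ident less_irrefl)
  with shelf shelf' have "l = l'"
    by (metis left_path_shelf_on_left_path_unique)
  \<comment> \<open>Neither root label occurs in its right subtree, so the common root block can be
    cancelled.\<close>
  have "?B \<notin> blocks r" "?B' \<notin> blocks r'"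
    using Union_blocks_subset[of r] Union_blocks_subset[of r'] shelf shelf' by blast+
  with B Node.prems(3) t' have "blocks r = blocks r'"
    by (simp add: insert_ident)
  moreover have "set_tree r = A - ?B"
    using shelf by auto
  moreover have "set_tree r' = A - ?B'"
    using shelf' by auto
  ultimately have "r = r'"
    using Node.IH(2) shelf shelf' B by metis
  with \<open>l = l'\<close> a t' show ?case by simp
qed

text \<open>The block containing the minimum becomes the root with its left path; the other blocks
  partition a smaller set and yield the right subtree.\<close>

lemma surj_on_blocks:
  assumes "finite A" "partition_on A P"
  shows "\<exists>t. left_path_shelf_on A t \<and> blocks t = P"
  using assms
proof (induction A arbitrary: P rule: finite_psubset_induct)
  case (psubset A)
  show ?case
  proof (cases "A = {}")
    case True
    with psubset.prems show ?thesis
      by (intro exI[of _ "\<langle>\<rangle>"]) (simp add: partition_on_empty)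
  next
    case False
    define a where "a = Min A"
    have a: "a \<in> A" "\<And>x. x \<in> A \<Longrightarrow> a \<le> x"
      using psubset.hyps False by (auto simp: a_def)
    then obtain B where B: "B \<in> P" "a \<in> B"
      using partition_onD1[OF psubset.prems] by blast
    have "B \<subseteq> A"
      using B partition_onD1[OF psubset.prems] by blast
    have "disjnt B (\<Union> (P - {B}))"
      using B(1) partition_onD2[OF psubset.prems] by (auto simp: disjnt_def disjoint_def)
    then have "partition_on (A - B) (P - {B})"
      using psubset.prems B(1) partition_on_insert[of B "P - {B}" A] by (simp add: insert_absorb)
    moreover have "A - B \<subset> A"
      using a(1) B(2) by blast
    ultimately obtain r where r: "left_path_shelf_on (A - B) r" "blocks r = P - {B}"
      using psubset.IH by blast
    have "finite (B - {a})"
      using \<open>B \<subseteq> A\<close> psubset.hyps finite_subset by blast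
    then obtain l where l: "left_path_shelf_on (B - {a}) l" "right l = \<langle>\<rangle>"
      using left_path_shelf_on_left_path_exists by blast
    have sets: "set_tree l = B - {a}" "set_tree r = A - B"
      using l r left_path_shelf_on_set_tree by auto
    \<comment> \<open>The inequality is strict because \<open>a\<close> lies in \<open>B\<close> and
      hence outside \<open>A - B\<close>.\<close>
    have "\<forall>x \<in> (B - {a}) \<union> (A - B). a < x"
      using a B(2) \<open>B \<subseteq> A\<close> by (metis Diff_iff UnE insertCI order_le_less subsetD)
    then have "left_path_shelf_on A \<langle>l, a, r\<rangle>"
      using l r sets B(2) \<open>B \<subseteq> A\<close> by (auto simp: left_path_shelf_on_Node)
    moreover have "blocks \<langle>l, a, r\<rangle> = P"
      using sets r(2) B by (auto simp: insert_absorb)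
    ultimately show ?thesis by blast
  qed
qed

lemma bij_betw_blocks:
  assumes "finite A"
  shows "bij_betw blocks {t. left_path_shelf_on A t} {P. partition_on A P}"
  unfolding bij_betw_def inj_on_def
  using inj_on_blocks partition_on_blocks surj_on_blocks[OF assms] by blast

lemma t_shelf_iff_left_path_shelf_on:
  "t_shelf n t \<and> no_left_child_has_right_child t \<longleftrightarrow> left_path_shelf_on {1..n} t"
proof -
  \<comment> \<open>The size is the length of the inorder list, which for distinct labels is the
    cardinality of \<open>{1..n}\<close>.\<close>
  have "size t = n" if "distinct (inorder t)" "set_tree t = {1..n}"
    using distinct_card[OF that(1)] that(2) by simp
  then show ?thesis
    by (auto simp: t_shelf_def left_path_shelf_on_def)
qed

theorem theorem10:
  fixes n :: nat
  shows "\<exists>f. bij_betw f {P. partition_on {1..n} P}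
                {t. t_shelf n t \<and> no_left_child_has_right_child t}"
  \<comment> \<open>The required map from partitions to trees is the inverse of
    \<open>blocks\<close>.\<close>
  using bij_betw_inv_into[OF bij_betw_blocks[of "{1..n}"]]
  by (auto simp: t_shelf_iff_left_path_shelf_on)

end
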